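(* Let $F$ be a subset of $2^\omega\times2^\omega$ of full measure. Then there exists a uniformly perfect tree $T\subseteq2^{<\omega}$ satisfying $[T]\times[T]\subseteq F\cup\Delta$, where $\Delta=\{(x,x):x\in2^\omega\}$.
   Context: $2^\omega\times2^\omega$ carries the standard product measure (the square of the fair-coin product measure on $2^\omega$), and full measure means that the complement is null. $2^{<\omega}=\bigcup_{n\in\omega}2^n$. A tree is a nonempty set $T\subseteq2^{<\omega}$ closed under initial segments. Its body is $[T]=\{x\in2^\omega:(\forall n)\ x\restriction n\in T\}$. Let $\mathrm{split}(T)=\{\sigma\in T:\sigma^\frown0\in T\text{ and }\sigma^\frown1\in T\}$. A tree $T$ is perfect if for every $\sigma\in T$ there is $\tau\in\mathrm{split}(T)$ with $\sigma\subseteq\tau$. A perfect tree $T$ is uniformly perfect if for every $n\in\omega$ either $2^n\cap T\subseteq\mathrm{split}(T)$ or $2^n\cap\mathrm{split}(T)=\emptyset$. *)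

theory Defs
  imports "HOL-Probability.Probability" "HOL-Library.Sublist"
begin

text \<open>Points of the Cantor space are functions \<^typ>\<open>nat \<Rightarrow> bool\<close>; finite binary
  sequences are lists of type \<^typ>\<open>bool list\<close>, with \<open>0\<close> and \<open>1\<close> rendered as
  \<^term>\<open>False\<close> and \<^term>\<open>True\<close>.\<close>

definition coin_measure :: "(nat \<Rightarrow> bool) measure" where
  "coin_measure = PiM UNIV (\<lambda>_. measure_pmf (bernoulli_pmf (1/2)))"

text \<open>The set need not be Borel: its complement only has to lie in a measurable set of
  measure zero, that is, to be null for the completed measure.\<close>

definition full_measure :: "'a measure \<Rightarrow> 'a set \<Rightarrow> bool" where
  "full_measure M F \<longleftrightarrow> F \<subseteq> space M \<and> space M - F \<in> null_sets (completion M)"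

definition restr :: "(nat \<Rightarrow> bool) \<Rightarrow> nat \<Rightarrow> bool list" where
  "restr x n = map x [0..<n]"

definition level :: "nat \<Rightarrow> bool list set" where
  "level n = {\<sigma>. length \<sigma> = n}"

definition is_tree :: "bool list set \<Rightarrow> bool" where
  "is_tree T \<longleftrightarrow> T \<noteq> {} \<and> (\<forall>\<tau>\<in>T. \<forall>\<sigma>. prefix \<sigma> \<tau> \<longrightarrow> \<sigma> \<in> T)"

definition body :: "bool list set \<Rightarrow> (nat \<Rightarrow> bool) set" where
  "body T = {x. \<forall>n. restr x n \<in> T}"

definition split_nodes :: "bool list set \<Rightarrow> bool list set" where
  "split_nodes T = {\<sigma>\<in>T. \<sigma> @ [False] \<in> T \<and> \<sigma> @ [True] \<in> T}"

definition perfect_tree :: "bool list set \<Rightarrow> bool" where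
  "perfect_tree T \<longleftrightarrow> is_tree T \<and> (\<forall>\<sigma>\<in>T. \<exists>\<tau>\<in>split_nodes T. prefix \<sigma> \<tau>)"

definition uniformly_perfect :: "bool list set \<Rightarrow> bool" where
  "uniformly_perfect T \<longleftrightarrow> perfect_tree T \<and>
     (\<forall>n. level n \<inter> T \<subseteq> split_nodes T \<or> level n \<inter> split_nodes T = {})"

lemma space_coin_measure [simp]: "space coin_measure = UNIV"
  by (simp add: coin_measure_def space_PiM)

lemma prob_space_coin_measure: "prob_space coin_measure"
  unfolding coin_measure_def by (intro prob_space_PiM measure_pmf.prob_space_axioms)

end

theory Submission
  imports Defs
begin

text \<open>The tree is found by the probabilistic method. Fix an infinite set \<open>S\<close> of splitting levels, and
  at every other level let each node \<open>\<sigma>\<close> choose its only successor by an independent fair coin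
  \<open>\<omega> \<sigma>\<close>. The resulting tree \<open>coin_tree S \<omega>\<close> is uniformly perfect whatever \<open>\<omega>\<close> is. Two of
  its branches that differ below level \<open>k\<close> consult different coins from there on, so apart from the
  first \<open>k\<close> levels and the levels in \<open>S\<close> they behave like two independent random points:
  by \<open>two_nodes_prob\<close>, nodes \<open>\<sigma>\<close>, \<open>\<tau>\<close> of length \<open>l\<close> that differ below \<open>k\<close> both lie in the
  tree with probability at most \<open>4 ^ k * 4 ^ card (S \<inter> {..<l})\<close> times the measure
  \<open>1 / 4 ^ l\<close> of the rectangle that they determine.

  The complement of \<open>F\<close> lies in a null set \<open>N\<close>. For every \<open>k\<close>, cover \<open>N\<close> by countably many clopen
  cylinders of tiny total measure (\<open>null_set_cylinder_cover\<close>). It suffices that no pair of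
  tree nodes differing below \<open>k\<close> enters a cylinder of the \<open>k\<close>-th cover: two different branches
  differ below some \<open>k\<close>, and if they formed a point of \<open>N\<close>, suitable initial segments of them would
  be such a pair. By the union bound, the probability of failure is at most the sum, over all
  cylinders of all covers, of the measure of the cylinder times
  \<open>4 ^ k * 4 ^ card (S \<inter> {..<l})\<close>, where \<open>l\<close> is its depth. The first factor is
  absorbed by the choice of the covers. The covers do not depend on \<open>S\<close>, so \<open>S\<close> can be
  chosen afterwards, and a convergent series tolerates a factor tending to infinity slowly enough;
  this is \<open>sparse_set_weights\<close>. The failure probability is then below \<open>1\<close>.\<close>

section \<open>Approximation by an algebra, and sparse sets of levels\<close>

text \<open>The measurable sets that, together with their complements, can be approximated from outside by
  countable unions from an algebra form a \<open>\<sigma>\<close>-algebra. Carrying the complement along is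
  what makes the class closed under complements; the countable union is then the only real case.\<close>

lemma outer_approximation_by_algebra:
  fixes e :: real
  assumes "finite_measure M" and alg: "algebra (space M) G"
    and sets_M: "sets M = sigma_sets (space M) G"
    and A: "A \<in> sets M" and e: "0 < e"
  shows "\<exists>B::nat \<Rightarrow> 'a set. range B \<subseteq> G \<and> A \<subseteq> (\<Union>i. B i) \<and> measure M ((\<Union>i. B i) - A) < e"
proof -
  interpret finite_measure M by fact
  interpret G: algebra "space M" G by fact
  define sigma_unions where "sigma_unions = {\<Union>i. B i | B::nat \<Rightarrow> 'a set. range B \<subseteq> G}"
  have G_sets: "B \<in> sets M" if "B \<in> G" for B
    unfolding sets_M using that by (rule sigma_sets.Basic)
  have su_sets: "U \<in> sets M" if "U \<in> sigma_unions" for U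
    using that G_sets by (auto simp: sigma_unions_def)
  have su_basic: "U \<in> sigma_unions" if "U \<in> G" for U
    unfolding sigma_unions_def using that by (auto intro!: exI[of _ "\<lambda>_. U"])
  have su_UN: "(\<Union>i::nat. U i) \<in> sigma_unions" if U: "\<And>i. U i \<in> sigma_unions" for U
  proof -
    obtain B :: "nat \<Rightarrow> nat \<Rightarrow> 'a set" where B: "\<And>i. range (B i) \<subseteq> G" "\<And>i. U i = (\<Union>j. B i j)"
      using U unfolding sigma_unions_def mem_Collect_eq by metis
    have "(\<Union>i. U i) = (\<Union>n. B (fst (prod_decode n)) (snd (prod_decode n)))"
      by (auto simp: B) (metis prod_encode_inverse fst_conv snd_conv)
    moreover have "range (\<lambda>n. B (fst (prod_decode n)) (snd (prod_decode n))) \<subseteq> G"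
      using B by auto
    ultimately show ?thesis unfolding sigma_unions_def by blast
  qed
  have su_Int: "U \<inter> V \<in> sigma_unions" if UV: "U \<in> sigma_unions" "V \<in> sigma_unions" for U V
  proof -
    obtain B C :: "nat \<Rightarrow> 'a set" where B: "range B \<subseteq> G" "U = (\<Union>i. B i)"
      and C: "range C \<subseteq> G" "V = (\<Union>i. C i)"
      using UV unfolding sigma_unions_def mem_Collect_eq by metis
    have "U \<inter> V = (\<Union>i. \<Union>j. B i \<inter> C j)" using B C by auto
    moreover have "(\<Union>i. \<Union>j. B i \<inter> C j) \<in> sigma_unions"
      using B C by (intro su_UN su_basic G.Int) auto
    ultimately show ?thesis by simp
  qed
  define approximable where "approximable A \<longleftrightarrow>
    (\<forall>e>0. \<exists>U\<in>sigma_unions. A \<subseteq> U \<and> measure M (U - A) < e)" for A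
  have approx_basic: "approximable B" if "B \<in> G" for B
    unfolding approximable_def using su_basic[OF that] by force
  have "approximable A \<and> approximable (space M - A)"
    using A unfolding sets_M
  proof (induction rule: sigma_sets.induct)
    case (Basic a)
    then show ?case by (auto intro!: approx_basic)
  next
    case Empty
    then show ?case by (auto intro!: approx_basic)
  next
    case (Compl a)
    then have "a \<subseteq> space M" using sets.sets_into_space sets_M by auto
    then have "space M - (space M - a) = a" by auto
    with Compl show ?case by simp
  next
    case (Union a)
    have a_sets: "a i \<in> sets M" for i using Union sets_M by auto
    have sums_e: "(\<lambda>i. e / 4 * (1 / 2) ^ i) sums (e / 2)" for e :: real
      using sums_mult[OF geometric_sums[of "1/2::real"], of "e/4"] by simp
    have small_union: "measure M (\<Union>i. D i) \<le> e / 2"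
      if D: "\<And>i. D i \<in> sets M" "\<And>i. measure M (D i) < e / 4 * (1 / 2) ^ i" for D and e :: real
    proof -
      have summ: "summable (\<lambda>i. measure M (D i))"
        by (rule summable_comparison_test'[OF sums_summable[OF sums_e[of e]]])
          (use D in \<open>auto intro: less_imp_le\<close>)
      have "measure M (\<Union>i. D i) \<le> (\<Sum>i. measure M (D i))"
        using D summ by (intro finite_measure_subadditive_countably) auto
      also have "\<dots> \<le> (\<Sum>i. e / 4 * (1 / 2) ^ i)"
        using D by (intro suminf_le summ sums_summable[OF sums_e]) (auto intro: less_imp_le)
      also have "\<dots> = e / 2" using sums_e by (rule sums_unique[symmetric])
      finally show ?thesis .
    qed
    have "approximable (\<Union>i. a i)"
      unfolding approximable_def
    proof (intro allI impI)
      fix e :: real assume e: "0 < e"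
      then have pos: "0 < e / 4 * (1 / 2) ^ i" for i :: nat by simp
      have "\<forall>i. \<exists>U\<in>sigma_unions. a i \<subseteq> U \<and> measure M (U - a i) < e / 4 * (1 / 2) ^ i"
        using Union.IH pos unfolding approximable_def by blast
      then obtain U where U: "\<And>i. U i \<in> sigma_unions" "\<And>i. a i \<subseteq> U i"
        "\<And>i. measure M (U i - a i) < e / 4 * (1 / 2) ^ i" by metis
      have "measure M ((\<Union>i. U i) - (\<Union>i. a i)) \<le> measure M (\<Union>i. U i - a i)"
        using U(1) su_sets a_sets by (intro finite_measure_mono) auto
      also have "\<dots> \<le> e / 2" using U su_sets a_sets by (intro small_union) auto
      also have "\<dots> < e" using e by simp
      finally show "\<exists>V\<in>sigma_unions. (\<Union>i. a i) \<subseteq> V \<and> measure M (V - (\<Union>i. a i)) < e"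
        using U by (intro bexI[of _ "\<Union>i. U i"] su_UN) auto
    qed
    moreover have "approximable (space M - (\<Union>i. a i))"
      unfolding approximable_def
    proof (intro allI impI)
      fix e :: real assume e: "0 < e"
      then have pos: "0 < e / 4 * (1 / 2) ^ i" for i :: nat by simp
      have "\<forall>i. \<exists>U\<in>sigma_unions. space M - a i \<subseteq> U \<and>
          measure M (U - (space M - a i)) < e / 4 * (1 / 2) ^ i"
        using Union.IH pos unfolding approximable_def by blast
      then obtain V where V: "\<And>i. V i \<in> sigma_unions" "\<And>i. space M - a i \<subseteq> V i"
        "\<And>i. measure M (V i - (space M - a i)) < e / 4 * (1 / 2) ^ i" by metis
      \<comment> \<open>Only finite intersections stay in the class, so the countable intersection is cut off
        at a stage beyond which the union of the \<open>a i\<close> gains little measure.\<close>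
      define R where "R n = (\<Union>i. a i) - (\<Union>i\<le>n. a i)" for n :: nat
      have R_sets: "R n \<in> sets M" for n unfolding R_def using a_sets by auto
      have "(\<lambda>n. measure M (R n)) \<longlonglongrightarrow> measure M (\<Inter>n. R n)"
        by (rule finite_Lim_measure_decseq) (use R_sets in \<open>auto simp: decseq_def R_def\<close>)
      moreover have "(\<Inter>n. R n) = {}" by (auto simp: R_def)
      ultimately have "eventually (\<lambda>n. measure M (R n) < e / 2) sequentially"
        using e by (intro order_tendstoD(2)[of _ 0]) auto
      then obtain n where n: "measure M (R n) < e / 2"
        by (auto simp: eventually_sequentially)
      define W where "W = (\<Inter>i\<in>{..n}. V i)"
      have W: "W \<in> sigma_unions"
        unfolding W_def
      proof (induction n)
        case (Suc n)
        have "(\<Inter>i\<in>{..Suc n}. V i) = (\<Inter>i\<in>{..n}. V i) \<inter> V (Suc n)" by (auto simp: atMost_Suc)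
        with Suc V(1) su_Int show ?case by simp
      qed (use V in simp)
      have a_sp: "a i \<subseteq> space M" for i using a_sets sets.sets_into_space by blast
      have D: "(\<Union>i. V i - (space M - a i)) \<in> sets M"
        using V(1) su_sets a_sets by auto
      have "measure M (W - (space M - (\<Union>i. a i)))
          \<le> measure M ((\<Union>i. V i - (space M - a i)) \<union> R n)"
      proof (rule finite_measure_mono)
        show "W - (space M - (\<Union>i. a i)) \<subseteq> (\<Union>i. V i - (space M - a i)) \<union> R n"
          using sets.sets_into_space[OF su_sets[OF W]] by (auto simp: W_def R_def)
      qed (use D R_sets in auto)
      also have "\<dots> \<le> measure M (\<Union>i. V i - (space M - a i)) + measure M (R n)"
        using D R_sets by (intro measure_Un_le) auto
      also have "\<dots> < e / 2 + e / 2"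
        using V su_sets a_sets by (intro add_le_less_mono n small_union) auto
      finally have "measure M (W - (space M - (\<Union>i. a i))) < e" by simp
      moreover have "space M - (\<Union>i. a i) \<subseteq> W" using V(2) by (auto simp: W_def)
      ultimately show "\<exists>U\<in>sigma_unions. space M - (\<Union>i. a i) \<subseteq> U \<and>
          measure M (U - (space M - (\<Union>i. a i))) < e" using W by auto
    qed
    ultimately show ?case ..
  qed
  then obtain U where "U \<in> sigma_unions" "A \<subseteq> U" "measure M (U - A) < e"
    using e unfolding approximable_def by blast
  then show ?thesis unfolding sigma_unions_def by blast
qed

text \<open>The factor \<open>4 ^ card (S \<inter> {..<l})\<close> is the price, in the union bound over pairs of nodes of
  length \<open>l\<close>, of letting the tree split at all levels in \<open>S\<close>. Since the mass of \<open>{x. s < h x}\<close>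
  tends to \<open>0\<close> as \<open>s\<close> grows, the \<open>j\<close>-th element of \<open>S\<close> can be placed so far out that its
  contribution to the integral is at most the \<open>j\<close>-th term of a geometric series.\<close>

lemma sparse_set_weights:
  fixes h :: "'a \<Rightarrow> nat" and e :: real
  assumes "finite_measure M" and h: "h \<in> measurable M (count_space UNIV)" and e: "0 < e"
  shows "\<exists>S. infinite S \<and>
    (\<integral>\<^sup>+x. 4 ^ card (S \<inter> {..<h x}) \<partial>M) \<le> emeasure M (space M) + ennreal e"
proof -
  interpret finite_measure M by fact
  define tail where "tail s = {x \<in> space M. s < h x}" for s
  have tail_sets [measurable]: "tail s \<in> sets M" for s
  proof -
    have "tail s = h -` {s<..} \<inter> space M" by (auto simp: tail_def)
    then show ?thesis using measurable_sets[OF h, of "{s<..}"] by simp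
  qed
  have "(\<lambda>s. measure M (tail s)) \<longlonglongrightarrow> measure M (\<Inter>s. tail s)"
    by (rule finite_Lim_measure_decseq)
      (use tail_sets in \<open>auto simp: decseq_def image_subset_iff\<close>, auto simp: tail_def)
  moreover have "(\<Inter>s. tail s) = {}" by (auto simp: tail_def)
  ultimately have tends: "(\<lambda>s. measure M (tail s)) \<longlonglongrightarrow> 0" by simp
  have "\<exists>r. \<forall>s\<ge>r. measure M (tail s) < e / 8 ^ Suc j" for j
    using order_tendstoD(2)[OF tends, of "e / 8 ^ Suc j"] e by (auto simp: eventually_sequentially)
  then obtain r where r: "\<And>j s. r j \<le> s \<Longrightarrow> measure M (tail s) < e / 8 ^ Suc j" by metis
  \<comment> \<open>Summing the thresholds makes \<open>s\<close> strictly increasing while keeping it above \<open>r\<close>.\<close>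
  define s where "s j = (\<Sum>i\<le>j. Suc (r i))" for j :: nat
  have "strict_mono s" by (rule strict_monoI_Suc) (simp add: s_def)
  have s_ge: "r j \<le> s j" for j
    unfolding s_def using member_le_sum[of j "{..j}" "\<lambda>i. Suc (r i)"] by simp
  define S where "S = range s"
  have "infinite S"
    unfolding S_def using \<open>strict_mono s\<close> by (simp add: range_inj_infinite strict_mono_imp_inj_on)
  \<comment> \<open>If \<open>s m\<close> is the last element of \<open>S\<close> below \<open>h x\<close>, the \<open>m\<close>-th term alone dominates the
    left-hand side; if there is none, the summand \<open>1\<close> does.\<close>
  have pointwise: "(4::ennreal) ^ card (S \<inter> {..<h x})
      \<le> 1 + (\<Sum>j. 4 ^ Suc j * indicator (tail (s j)) x)" if x: "x \<in> space M" for x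
  proof (cases "{j. s j < h x} = {}")
    case True
    then have "S \<inter> {..<h x} = {}" by (auto simp: S_def)
    then show ?thesis by simp
  next
    case False
    have fin: "finite {j. s j < h x}"
      by (rule finite_subset[of _ "{..<h x}"])
        (use strict_mono_imp_increasing[OF \<open>strict_mono s\<close>] in \<open>auto intro: le_less_trans\<close>)
    define m where "m = Max {j. s j < h x}"
    have m: "s m < h x" using Max_in[OF fin False] by (simp add: m_def)
    have "S \<inter> {..<h x} \<subseteq> s ` {..m}"
      using Max_ge[OF fin] by (auto simp: S_def m_def)
    then have "card (S \<inter> {..<h x}) \<le> Suc m"
      using surj_card_le[of "{..m}" "S \<inter> {..<h x}" s] by simp
    then have "(4::ennreal) ^ card (S \<inter> {..<h x}) \<le> 4 ^ Suc m"
      by (intro power_increasing) auto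
    also have "\<dots> = (\<Sum>j\<in>{m}. 4 ^ Suc j * indicator (tail (s j)) x)"
      using m x by (simp add: tail_def)
    also have "\<dots> \<le> (\<Sum>j. 4 ^ Suc j * indicator (tail (s j)) x)"
      by (intro sum_le_suminf) auto
    finally show ?thesis by (simp add: add_increasing)
  qed
  have "(\<integral>\<^sup>+x. 4 ^ card (S \<inter> {..<h x}) \<partial>M)
      \<le> (\<integral>\<^sup>+x. 1 + (\<Sum>j. 4 ^ Suc j * indicator (tail (s j)) x) \<partial>M)"
    by (intro nn_integral_mono pointwise)
  also have "\<dots> = emeasure M (space M) + (\<Sum>j. 4 ^ Suc j * emeasure M (tail (s j)))"
    by (simp add: nn_integral_add nn_integral_suminf nn_integral_cmult del: power_Suc)
  also have "(\<Sum>j. 4 ^ Suc j * emeasure M (tail (s j))) \<le> (\<Sum>j. ennreal (e / 2 * (1 / 2) ^ j))"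
  proof (rule suminf_le)
    fix j
    have "4 ^ Suc j * emeasure M (tail (s j)) = ennreal (4 ^ Suc j * measure M (tail (s j)))"
      by (simp add: emeasure_eq_measure ennreal_mult' ennreal_power[symmetric] del: power_Suc)
    also have "\<dots> \<le> ennreal (4 ^ Suc j * (e / 8 ^ Suc j))"
      using r[OF s_ge[of j]] by (intro ennreal_leI mult_left_mono) auto
    also have "4 ^ Suc j * (e / 8 ^ Suc j) = e / 2 * (1 / 2) ^ j"
    proof -
      have "(8::real) ^ Suc j = 4 ^ Suc j * 2 ^ Suc j" by (simp flip: power_mult_distrib)
      then show ?thesis by (simp add: power_divide)
    qed
    finally show "4 ^ Suc j * emeasure M (tail (s j)) \<le> ennreal (e / 2 * (1 / 2) ^ j)" .
  qed auto
  also have "(\<Sum>j. ennreal (e / 2 * (1 / 2) ^ j)) = ennreal e"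
    using e sums_mult[OF geometric_sums[of "1/2::real"], of "e/2"]
    by (intro suminf_ennreal_eq) auto
  finally show ?thesis using \<open>infinite S\<close> by (auto intro: add_left_mono)
qed

section \<open>Fair coins and cylinders\<close>

lemma fair_coins_agree_prob:
  assumes "finite J"
  shows "emeasure (PiM UNIV (\<lambda>_::'i. measure_pmf (bernoulli_pmf (1/2)))) {\<omega>. \<forall>j\<in>J. \<omega> j = v j}
    = ennreal ((1/2) ^ card J)"
proof -
  interpret product_prob_space "\<lambda>_::'i. measure_pmf (bernoulli_pmf (1/2))" UNIV
    by unfold_locales
  have "emeasure (measure_pmf (bernoulli_pmf (1/2))) {b} = ennreal (1/2)" for b
    by (cases b) (simp_all add: emeasure_pmf_single)
  then show ?thesis
    using emeasure_PiM_Collect[of J "\<lambda>j. {v j}"] assms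
    by (simp add: space_PiM prod_ennreal[symmetric] ennreal_power[symmetric])
qed

lemma fair_coins_agree_sets:
  assumes "finite J"
  shows "{\<omega>. \<forall>j\<in>J. \<omega> j = v j} \<in> sets (PiM UNIV (\<lambda>_::'i. measure_pmf (bernoulli_pmf (1/2))))"
proof -
  have "{\<omega> \<in> space (PiM UNIV (\<lambda>_::'i. measure_pmf (bernoulli_pmf (1/2)))). \<forall>j\<in>J. \<omega> j \<in> {v j}}
      \<in> sets (PiM UNIV (\<lambda>_::'i. measure_pmf (bernoulli_pmf (1/2))))"
    using assms by (intro sets.sets_Collect_finite_All sets_Collect_single) auto
  then show ?thesis by (simp add: space_PiM)
qed

definition cylinder :: "nat \<Rightarrow> (bool list \<times> bool list) set \<Rightarrow> ((nat \<Rightarrow> bool) \<times> (nat \<Rightarrow> bool)) set" where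
  "cylinder l P = {(x, y). (restr x l, restr y l) \<in> P}"

lemma length_restr [simp]: "length (restr x n) = n"
  by (simp add: restr_def)

lemma take_restr: "k \<le> l \<Longrightarrow> take k (restr x l) = restr x k"
  by (simp add: restr_def take_map)

lemma restr_eq_iff: "restr x l = \<sigma> \<longleftrightarrow> length \<sigma> = l \<and> (\<forall>n<l. x n = \<sigma> ! n)"
  by (auto simp: restr_def list_eq_iff_nth_eq)

text \<open>Rewriting a cylinder at a deeper level serves two purposes: two cylinders can be compared at a
  common level, and the cylinders of a cover can be required to be as deep as desired.\<close>

lemma cylinder_lift:
  assumes "l \<le> l'"
  shows "\<exists>P' \<subseteq> level l' \<times> level l'. cylinder l P = cylinder l' P'"
proof (intro exI conjI)
  let ?P = "{(\<sigma>, \<tau>) \<in> level l' \<times> level l'. (take l \<sigma>, take l \<tau>) \<in> P}"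
  show "?P \<subseteq> level l' \<times> level l'" by auto
  show "cylinder l P = cylinder l' ?P"
    using assms by (auto simp: cylinder_def level_def take_restr)
qed

lemma algebra_cylinders: "algebra UNIV (range (\<lambda>(l, P). cylinder l P))"
  unfolding algebra_iff_Un
proof (intro conjI ballI)
  show "{} \<in> range (\<lambda>(l, P). cylinder l P)"
    by (rule image_eqI[of _ _ "(0, {})"]) (auto simp: cylinder_def)
next
  fix a assume "a \<in> range (\<lambda>(l, P). cylinder l P)"
  then obtain l P where "a = cylinder l P" by auto
  then have "UNIV - a = cylinder l (- P)" by (auto simp: cylinder_def)
  then show "UNIV - a \<in> range (\<lambda>(l, P). cylinder l P)" by (auto intro: image_eqI[of _ _ "(l, - P)"])
next
  fix a b assume "a \<in> range (\<lambda>(l, P). cylinder l P)" "b \<in> range (\<lambda>(l, P). cylinder l P)"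
  then obtain l P l' P' where ab: "a = cylinder l P" "b = cylinder l' P'" by auto
  define m where "m = max l l'"
  obtain Q Q' where "a = cylinder m Q" "b = cylinder m Q'"
    using cylinder_lift[of l m P] cylinder_lift[of l' m P'] ab by (auto simp: m_def)
  then have "a \<union> b = cylinder m (Q \<union> Q')" by (auto simp: cylinder_def)
  then show "a \<union> b \<in> range (\<lambda>(l, P). cylinder l P)" by (auto intro: image_eqI[of _ _ "(m, Q \<union> Q')"])
qed auto

lemma finite_level [simp]: "finite (level l)"
  unfolding level_def using finite_lists_length_eq[of "UNIV :: bool set" l] by simp

lemma emeasure_coin_restr: "emeasure coin_measure {x. restr x (length \<sigma>) = \<sigma>} = ennreal ((1/2) ^ length \<sigma>)"
  and sets_coin_restr: "{x. restr x (length \<sigma>) = \<sigma>} \<in> sets coin_measure"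
proof -
  have *: "{x. restr x (length \<sigma>) = \<sigma>} = {x. \<forall>j\<in>{..<length \<sigma>}. x j = \<sigma> ! j}"
    by (auto simp: restr_eq_iff)
  show "emeasure coin_measure {x. restr x (length \<sigma>) = \<sigma>} = ennreal ((1/2) ^ length \<sigma>)"
    unfolding * coin_measure_def by (subst fair_coins_agree_prob) auto
  show "{x. restr x (length \<sigma>) = \<sigma>} \<in> sets coin_measure"
    unfolding * coin_measure_def by (intro fair_coins_agree_sets) auto
qed

lemma cylinder_sets_and_measure:
  assumes P: "P \<subseteq> level l \<times> level l"
  shows "cylinder l P \<in> sets (coin_measure \<Otimes>\<^sub>M coin_measure)"
    and "emeasure (coin_measure \<Otimes>\<^sub>M coin_measure) (cylinder l P) = ennreal (real (card P) / 4 ^ l)"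
proof -
  interpret prob_space coin_measure by (rule prob_space_coin_measure)
  define rect where "rect = (\<lambda>(\<sigma>, \<tau>). {x. restr x l = \<sigma>} \<times> {x. restr x l = \<tau>})"
  have fin: "finite P" using P by (rule finite_subset) simp
  have cyl: "cylinder l P = (\<Union>p\<in>P. rect p)" by (auto simp: cylinder_def rect_def)
  have rect_sets: "rect p \<in> sets (coin_measure \<Otimes>\<^sub>M coin_measure)" if pP: "p \<in> P" for p
  proof -
    obtain \<sigma> \<tau> where p: "p = (\<sigma>, \<tau>)" "length \<sigma> = l" "length \<tau> = l"
      using pP P by (cases p) (force simp: level_def)
    then show ?thesis using sets_coin_restr[of \<sigma>] sets_coin_restr[of \<tau>] by (simp add: rect_def)
  qed
  have rect_meas: "emeasure (coin_measure \<Otimes>\<^sub>M coin_measure) (rect p) = ennreal (1 / 4 ^ l)"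
    if pP: "p \<in> P" for p
  proof -
    obtain \<sigma> \<tau> where p: "p = (\<sigma>, \<tau>)" "length \<sigma> = l" "length \<tau> = l"
      using pP P by (cases p) (force simp: level_def)
    have "emeasure (coin_measure \<Otimes>\<^sub>M coin_measure) (rect p)
        = ennreal ((1/2) ^ l) * ennreal ((1/2) ^ l)"
      using sets_coin_restr[of \<sigma>] sets_coin_restr[of \<tau>]
        emeasure_coin_restr[of \<sigma>] emeasure_coin_restr[of \<tau>] p
      by (simp add: rect_def emeasure_pair_measure_Times)
    also have "\<dots> = ennreal ((1/2) ^ l * (1/2) ^ l)" by (rule ennreal_mult[symmetric]) auto
    also have "(1/2) ^ l * (1/2) ^ l = 1 / (4::real) ^ l"
      by (simp add: power_mult_distrib[symmetric] power_divide)
    finally show ?thesis .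
  qed
  show "cylinder l P \<in> sets (coin_measure \<Otimes>\<^sub>M coin_measure)"
    unfolding cyl using fin rect_sets by auto
  have "emeasure (coin_measure \<Otimes>\<^sub>M coin_measure) (cylinder l P)
      = (\<Sum>p\<in>P. emeasure (coin_measure \<Otimes>\<^sub>M coin_measure) (rect p))"
    unfolding cyl using fin rect_sets
    by (intro sum_emeasure[symmetric]) (auto simp: disjoint_family_on_def rect_def)
  also have "\<dots> = ennreal (real (card P) / 4 ^ l)"
    by (simp add: rect_meas ennreal_of_nat_eq_real_of_nat flip: ennreal_mult'')
  finally show "emeasure (coin_measure \<Otimes>\<^sub>M coin_measure) (cylinder l P)
      = ennreal (real (card P) / 4 ^ l)" .
qed

lemma sets_coin_pair:
  "sets (coin_measure \<Otimes>\<^sub>M coin_measure) = sigma_sets UNIV (range (\<lambda>(l, P). cylinder l P))"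
proof (intro equalityI)
  define G where "G = sigma UNIV (range (\<lambda>(l, P). cylinder l P))"
  have [simp]: "space G = UNIV" by (simp add: G_def space_measure_of_conv)
  have sets_G: "sets G = sigma_sets UNIV (range (\<lambda>(l, P). cylinder l P))"
    by (simp add: G_def sets_measure_of_conv)
  have coord: "{z. fst z n \<in> A} \<in> sets G" "{z. snd z n \<in> A} \<in> sets G" for n A
  proof -
    have "{z. fst z n \<in> A} = cylinder (Suc n) {(\<sigma>, \<tau>). \<sigma> ! n \<in> A}"
      "{z. snd z n \<in> A} = cylinder (Suc n) {(\<sigma>, \<tau>). \<tau> ! n \<in> A}"
      by (auto simp: cylinder_def restr_def simp del: upt_Suc)
    then show "{z. fst z n \<in> A} \<in> sets G" "{z. snd z n \<in> A} \<in> sets G"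
      unfolding sets_G by (auto intro!: sigma_sets.Basic)
  qed
  have "(\<lambda>z n. fst z n) \<in> measurable G coin_measure"
    unfolding coin_measure_def
    by (rule measurable_PiM_single'[where f = "\<lambda>n z. fst z n"])
      (use coord in \<open>auto simp: measurable_def vimage_def\<close>)
  moreover have "(\<lambda>z n. snd z n) \<in> measurable G coin_measure"
    unfolding coin_measure_def
    by (rule measurable_PiM_single'[where f = "\<lambda>n z. snd z n"])
      (use coord in \<open>auto simp: measurable_def vimage_def\<close>)
  ultimately have "(\<lambda>z. (fst z, snd z)) \<in> measurable G (coin_measure \<Otimes>\<^sub>M coin_measure)"
    by (rule measurable_Pair)
  then have "(\<lambda>z. z) \<in> measurable G (coin_measure \<Otimes>\<^sub>M coin_measure)" by simp
  then show "sets (coin_measure \<Otimes>\<^sub>M coin_measure) \<subseteq> sigma_sets UNIV (range (\<lambda>(l, P). cylinder l P))"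
    unfolding sets_G[symmetric] using measurable_sets[of "\<lambda>z. z"] by force
  show "sigma_sets UNIV (range (\<lambda>(l, P). cylinder l P)) \<subseteq> sets (coin_measure \<Otimes>\<^sub>M coin_measure)"
  proof -
    have "cylinder l P \<in> sets (coin_measure \<Otimes>\<^sub>M coin_measure)" for l P
      using cylinder_lift[of l l P] cylinder_sets_and_measure(1) by auto
    then have "range (\<lambda>(l, P). cylinder l P) \<subseteq> sets (coin_measure \<Otimes>\<^sub>M coin_measure)" by auto
    from sets.sigma_sets_subset[OF this] show ?thesis by (simp add: space_pair_measure)
  qed
qed

text \<open>Making the cylinders of the approximating union disjoint turns the measure of the union, which
  is what the approximation controls, into the sum of the individual measures, which is what a union
  bound needs.\<close>

lemma null_set_cylinder_cover:
  fixes e :: real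
  assumes N: "N \<in> null_sets (coin_measure \<Otimes>\<^sub>M coin_measure)" and e: "0 < e"
  shows "\<exists>l P. (\<forall>i::nat. k \<le> l i \<and> P i \<subseteq> level (l i) \<times> level (l i)) \<and>
    N \<subseteq> (\<Union>i. cylinder (l i) (P i)) \<and> (\<Sum>i. ennreal (real (card (P i)) / 4 ^ l i)) \<le> ennreal e"
proof -
  let ?M = "coin_measure \<Otimes>\<^sub>M coin_measure"
  let ?G = "range (\<lambda>(l, P). cylinder l P)"
  interpret C: prob_space coin_measure by (rule prob_space_coin_measure)
  interpret M: pair_prob_space coin_measure coin_measure by unfold_locales
  have space_M: "space ?M = UNIV" by (simp add: space_pair_measure)
  interpret G: algebra UNIV ?G by (rule algebra_cylinders)
  obtain B :: "nat \<Rightarrow> _" where B: "range B \<subseteq> ?G" "N \<subseteq> (\<Union>i. B i)" "measure ?M ((\<Union>i. B i) - N) < e"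
    using outer_approximation_by_algebra[of ?M ?G N e] N e
    by (auto simp: space_M sets_coin_pair algebra_cylinders M.finite_measure_axioms null_sets_def)
  have "\<exists>l P. k \<le> l \<and> P \<subseteq> level l \<times> level l \<and> disjointed B i = cylinder l P" for i
  proof -
    have "disjointed B i \<in> ?G" using G.range_disjointed_sets'[OF B(1)] by blast
    then obtain l0 P0 where "disjointed B i = cylinder l0 P0" by auto
    then show ?thesis using cylinder_lift[of l0 "max k l0" P0] by (metis max.cobounded1 max.cobounded2)
  qed
  then obtain l P where lP: "\<And>i. k \<le> l i" "\<And>i. P i \<subseteq> level (l i) \<times> level (l i)"
    "\<And>i. disjointed B i = cylinder (l i) (P i)" by metis
  have cyl_sets: "range (\<lambda>i. cylinder (l i) (P i)) \<subseteq> sets ?M"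
    using cylinder_sets_and_measure(1)[OF lP(2)] by auto
  have disj: "disjoint_family (\<lambda>i. cylinder (l i) (P i))"
    using disjoint_family_disjointed[of B] by (simp flip: lP(3))
  have un: "(\<Union>i. cylinder (l i) (P i)) = (\<Union>i. B i)"
    using UN_disjointed_eq[of B] by (simp add: lP)
  have "(\<Sum>i. ennreal (real (card (P i)) / 4 ^ l i)) = (\<Sum>i. emeasure ?M (cylinder (l i) (P i)))"
    by (simp add: cylinder_sets_and_measure(2)[OF lP(2)])
  also have "\<dots> = emeasure ?M (\<Union>i. cylinder (l i) (P i))"
    using disj cyl_sets by (rule suminf_emeasure[rotated])
  also have "\<dots> = emeasure ?M ((\<Union>i. B i) - N)"
    unfolding un[symmetric] using cyl_sets
    by (intro emeasure_Diff_null_set[symmetric, OF N]) auto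
  also have "\<dots> \<le> ennreal e"
    using B(3) by (simp add: M.emeasure_eq_measure ennreal_leI)
  finally have "(\<Sum>i. ennreal (real (card (P i)) / 4 ^ l i)) \<le> ennreal e" .
  moreover have "\<forall>i. k \<le> l i \<and> P i \<subseteq> level (l i) \<times> level (l i)" using lP(1,2) by simp
  moreover have "N \<subseteq> (\<Union>i. cylinder (l i) (P i))" using B(2) un by simp
  ultimately show ?thesis by (intro exI[of _ l] exI[of _ P] conjI)
qed

section \<open>Random uniformly perfect trees\<close>

text \<open>At a level in \<open>S\<close> every node splits; at any other level a node \<open>\<sigma>\<close> has exactly one
  successor, \<open>\<sigma> @ [\<omega> \<sigma>]\<close>. With independent fair coins \<open>\<omega> \<sigma>\<close>, one for each finite sequence,
  this is a random tree.\<close>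

definition coin_tree :: "nat set \<Rightarrow> (bool list \<Rightarrow> bool) \<Rightarrow> bool list set" where
  "coin_tree S \<omega> = {\<sigma>. \<forall>n<length \<sigma>. n \<notin> S \<longrightarrow> \<sigma> ! n = \<omega> (take n \<sigma>)}"

lemma coin_tree_prefix: "\<tau> \<in> coin_tree S \<omega> \<Longrightarrow> prefix \<sigma> \<tau> \<Longrightarrow> \<sigma> \<in> coin_tree S \<omega>"
  unfolding coin_tree_def prefix_def
proof (clarsimp)
  fix \<rho> n
  assume "\<forall>n<length \<sigma> + length \<rho>. n \<notin> S \<longrightarrow> (\<sigma> @ \<rho>) ! n = \<omega> (take n \<sigma> @ take (n - length \<sigma>) \<rho>)"
    and n: "n < length \<sigma>" "n \<notin> S"
  then have "(\<sigma> @ \<rho>) ! n = \<omega> (take n \<sigma> @ take (n - length \<sigma>) \<rho>)" by simp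
  then show "\<sigma> ! n = \<omega> (take n \<sigma>)" using n by (simp add: nth_append)
qed

lemma coin_tree_snoc:
  "\<sigma> \<in> coin_tree S \<omega> \<Longrightarrow> \<sigma> @ [b] \<in> coin_tree S \<omega> \<longleftrightarrow> length \<sigma> \<in> S \<or> b = \<omega> \<sigma>"
  by (auto simp: coin_tree_def nth_append All_less_Suc)

lemma coin_tree_extend:
  assumes "\<sigma> \<in> coin_tree S \<omega>"
  shows "\<exists>\<tau>\<in>coin_tree S \<omega>. prefix \<sigma> \<tau> \<and> length \<tau> = length \<sigma> + d"
proof (induction d)
  case (Suc d)
  then obtain \<tau> where "\<tau> \<in> coin_tree S \<omega>" "prefix \<sigma> \<tau>" "length \<tau> = length \<sigma> + d" by blast
  then show ?case by (intro bexI[of _ "\<tau> @ [\<omega> \<tau>]"]) (auto simp: coin_tree_snoc)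
qed (use assms in auto)

lemma split_nodes_coin_tree: "split_nodes (coin_tree S \<omega>) = {\<sigma> \<in> coin_tree S \<omega>. length \<sigma> \<in> S}"
  by (auto simp: split_nodes_def coin_tree_snoc)

lemma uniformly_perfect_coin_tree:
  assumes "infinite S"
  shows "uniformly_perfect (coin_tree S \<omega>)"
proof -
  have "[] \<in> coin_tree S \<omega>" by (simp add: coin_tree_def)
  then have "is_tree (coin_tree S \<omega>)" unfolding is_tree_def using coin_tree_prefix by blast
  moreover have "\<exists>\<tau>\<in>split_nodes (coin_tree S \<omega>). prefix \<sigma> \<tau>" if \<sigma>: "\<sigma> \<in> coin_tree S \<omega>" for \<sigma>
  proof -
    obtain m where "m \<in> S" "length \<sigma> \<le> m" using assms infinite_nat_iff_unbounded_le by blast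
    then show ?thesis
      using coin_tree_extend[OF \<sigma>, of "m - length \<sigma>"] by (auto simp: split_nodes_coin_tree)
  qed
  ultimately show ?thesis
    unfolding uniformly_perfect_def perfect_tree_def by (auto simp: split_nodes_coin_tree level_def)
qed

definition tree_coins :: "(bool list \<Rightarrow> bool) measure" where
  "tree_coins = PiM UNIV (\<lambda>_. measure_pmf (bernoulli_pmf (1/2)))"

lemma space_tree_coins [simp]: "space tree_coins = UNIV"
  by (simp add: tree_coins_def space_PiM)

lemma node_event_sets: "{\<omega>. \<sigma> \<in> coin_tree S \<omega>} \<in> sets tree_coins"
proof -
  have "{\<omega>. \<sigma> \<in> coin_tree S \<omega>}
      = {\<omega>. \<forall>\<rho>\<in>(\<lambda>n. take n \<sigma>) ` ({..<length \<sigma>} - S). \<omega> \<rho> = \<sigma> ! length \<rho>}"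
    by (auto simp: coin_tree_def)
  also have "\<dots> \<in> sets tree_coins"
    unfolding tree_coins_def by (intro fair_coins_agree_sets) auto
  finally show ?thesis .
qed

text \<open>From length \<open>k\<close> on, the initial segments of \<open>\<sigma>\<close> and those of \<open>\<tau>\<close> are pairwise different, so
  outside \<open>S\<close> each of them consults its own coin. Membership of both nodes therefore prescribes
  at least \<open>2 * (l - k - card (S \<inter> {..<l}))\<close> independent coins.\<close>

lemma two_nodes_prob:
  assumes len: "length \<sigma> = l" "length \<tau> = l" and split: "take k \<sigma> \<noteq> take k \<tau>"
  shows "emeasure tree_coins {\<omega>. \<sigma> \<in> coin_tree S \<omega> \<and> \<tau> \<in> coin_tree S \<omega>}
    \<le> ennreal (4 ^ k * 4 ^ card (S \<inter> {..<l}) / 4 ^ l)"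
proof -
  define I where "I = {k..<l} - S"
  define J where "J = (\<lambda>n. take n \<sigma>) ` I"
  define J' where "J' = (\<lambda>n. take n \<tau>) ` I"
  define v where "v \<rho> = (if \<rho> \<in> J then \<sigma> ! length \<rho> else \<tau> ! length \<rho>)" for \<rho>
  have disj: "J \<inter> J' = {}"
  proof (rule ccontr)
    assume "J \<inter> J' \<noteq> {}"
    then obtain n m where nm: "n \<in> I" "m \<in> I" "take n \<sigma> = take m \<tau>" by (auto simp: J_def J'_def)
    then have "n = m" using len by (metis I_def DiffD1 atLeastLessThan_iff length_take min.absorb4)
    with nm(3) have "take k (take n \<sigma>) = take k (take n \<tau>)" by simp
    moreover have "k \<le> n" using nm(1) by (simp add: I_def)
    ultimately show False using split by (simp add: min_def)
  qed
  have "inj_on (\<lambda>n. take n \<rho>) I" if "length \<rho> = l" for \<rho> :: "bool list"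
    by (rule inj_on_inverseI[where g = length]) (use that in \<open>simp add: I_def\<close>)
  then have "card J = card I" "card J' = card I" using len by (auto simp: J_def J'_def card_image)
  moreover have fin: "finite J" "finite J'" by (auto simp: J_def J'_def I_def)
  ultimately have card_J: "card (J \<union> J') = 2 * card I"
    using disj by (simp add: card_Un_disjoint)
  have "card {..<l} \<le> card ({..<k} \<union> (S \<inter> {..<l}) \<union> I)"
    by (rule card_mono) (auto simp: I_def)
  also have "\<dots> \<le> k + card (S \<inter> {..<l}) + card I"
    using card_Un_le[of "{..<k} \<union> (S \<inter> {..<l})" I] card_Un_le[of "{..<k}" "S \<inter> {..<l}"] by simp
  finally have card_I: "l \<le> k + card (S \<inter> {..<l}) + card I" by simp
  have "emeasure tree_coins {\<omega>. \<sigma> \<in> coin_tree S \<omega> \<and> \<tau> \<in> coin_tree S \<omega>}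
      \<le> emeasure tree_coins {\<omega>. \<forall>\<rho>\<in>J \<union> J'. \<omega> \<rho> = v \<rho>}"
  proof (rule emeasure_mono)
    show "{\<omega>. \<sigma> \<in> coin_tree S \<omega> \<and> \<tau> \<in> coin_tree S \<omega>} \<subseteq> {\<omega>. \<forall>\<rho>\<in>J \<union> J'. \<omega> \<rho> = v \<rho>}"
    proof (intro subsetI CollectI ballI)
      fix \<omega> \<rho> assume \<omega>: "\<omega> \<in> {\<omega>. \<sigma> \<in> coin_tree S \<omega> \<and> \<tau> \<in> coin_tree S \<omega>}" and "\<rho> \<in> J \<union> J'"
      then consider "\<rho> \<in> J" | "\<rho> \<notin> J" "\<rho> \<in> J'" by blast
      then show "\<omega> \<rho> = v \<rho>"
        using \<omega> len by cases (auto simp: v_def J_def J'_def I_def coin_tree_def)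
    qed
    show "{\<omega>. \<forall>\<rho>\<in>J \<union> J'. \<omega> \<rho> = v \<rho>} \<in> sets tree_coins"
      unfolding tree_coins_def by (rule fair_coins_agree_sets) (simp add: fin)
  qed
  also have "\<dots> = ennreal ((1/2) ^ (2 * card I))"
    unfolding tree_coins_def using fin card_J by (subst fair_coins_agree_prob) simp_all
  also have "\<dots> \<le> ennreal (4 ^ k * 4 ^ card (S \<inter> {..<l}) / 4 ^ l)"
  proof (rule ennreal_leI)
    have "(4::real) ^ l \<le> 4 ^ (k + card (S \<inter> {..<l}) + card I)"
      using card_I by (rule power_increasing) simp
    then have "1 / (4::real) ^ card I \<le> 4 ^ k * 4 ^ card (S \<inter> {..<l}) / 4 ^ l"
      by (simp add: pos_le_divide_eq pos_divide_le_eq power_add)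
    then show "(1/2::real) ^ (2 * card I) \<le> 4 ^ k * 4 ^ card (S \<inter> {..<l}) / 4 ^ l"
      by (simp add: power_mult power_divide)
  qed
  finally show ?thesis .
qed

text \<open>The union bound over the pairs in \<open>P\<close>. The bound is the measure of the cylinder over \<open>P\<close>, up
  to the factor \<open>4 ^ k\<close> for the common initial segment and the factor for the splitting levels.\<close>

lemma bad_event_prob:
  fixes k :: nat and S :: "nat set"
  assumes P: "P \<subseteq> level l \<times> level l"
  defines "bad \<equiv> {\<omega>. \<exists>(\<sigma>, \<tau>)\<in>P. take k \<sigma> \<noteq> take k \<tau> \<and> \<sigma> \<in> coin_tree S \<omega> \<and> \<tau> \<in> coin_tree S \<omega>}"
  shows "bad \<in> sets tree_coins"
    and "emeasure tree_coins bad
      \<le> 4 ^ k * ennreal (real (card P) / 4 ^ l) * 4 ^ card (S \<inter> {..<l})"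
proof -
  define Q where "Q = {(\<sigma>, \<tau>) \<in> P. take k \<sigma> \<noteq> take k \<tau>}"
  define E where "E = (\<lambda>(\<sigma>, \<tau>). {\<omega>. \<sigma> \<in> coin_tree S \<omega> \<and> \<tau> \<in> coin_tree S \<omega>})"
  have finP: "finite P" using P by (rule finite_subset) simp
  then have fin: "finite Q" by (rule rev_finite_subset) (auto simp: Q_def)
  have E_sets: "E q \<in> sets tree_coins" for q
    using node_event_sets by (cases q) (simp add: E_def Collect_conj_eq sets.Int)
  have bad: "bad = (\<Union>q\<in>Q. E q)" by (auto simp: bad_def Q_def E_def)
  show "bad \<in> sets tree_coins" unfolding bad using fin E_sets by auto
  have "emeasure tree_coins bad \<le> (\<Sum>q\<in>Q. emeasure tree_coins (E q))"
    unfolding bad using fin E_sets by (intro emeasure_subadditive_finite) auto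
  also have "\<dots> \<le> (\<Sum>q\<in>Q. ennreal (4 ^ k * 4 ^ card (S \<inter> {..<l}) / 4 ^ l))"
  proof (rule sum_mono)
    fix q assume "q \<in> Q"
    then show "emeasure tree_coins (E q) \<le> ennreal (4 ^ k * 4 ^ card (S \<inter> {..<l}) / 4 ^ l)"
      using P by (cases q) (auto simp: Q_def E_def level_def intro!: two_nodes_prob)
  qed
  also have "\<dots> \<le> (\<Sum>q\<in>P. ennreal (4 ^ k * 4 ^ card (S \<inter> {..<l}) / 4 ^ l))"
    using finP by (intro sum_mono2) (auto simp: Q_def)
  also have "\<dots> = ennreal (4 ^ k * (real (card P) / 4 ^ l) * 4 ^ card (S \<inter> {..<l}))"
    by (subst sum_ennreal) (simp_all add: field_simps)
  also have "\<dots> = 4 ^ k * ennreal (real (card P) / 4 ^ l) * 4 ^ card (S \<inter> {..<l})"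
    by (subst ennreal_mult, simp, simp, subst ennreal_mult, simp, simp)
      (simp add: ennreal_power[symmetric])
  finally show "emeasure tree_coins bad
      \<le> 4 ^ k * ennreal (real (card P) / 4 ^ l) * 4 ^ card (S \<inter> {..<l})" .
qed

section \<open>Choosing the splitting levels and the coins\<close>

lemma nn_integral_count_space_nat_pairs:
  "(\<integral>\<^sup>+p. f p \<partial>count_space (UNIV :: (nat \<times> nat) set)) = (\<Sum>k. \<Sum>i. f (k, i))"
  by (simp add: nn_integral_fst_count_space[symmetric] nn_integral_count_space_nat)

text \<open>The \<open>k\<close>-th cover has total measure at most \<open>1 / 8 ^ Suc k\<close>, which absorbs the factor
  \<open>4 ^ k\<close> and still sums to \<open>1 / 4\<close> over all \<open>k\<close>. A sparse set of splitting levels adds at most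
  another \<open>1 / 4\<close>, so the bad events have total probability at most \<open>1 / 2\<close>, and some choice of
  coins avoids all of them.\<close>

lemma coin_tree_avoiding_covers:
  fixes l :: "nat \<Rightarrow> nat \<Rightarrow> nat"
  assumes P: "\<And>k i. P k i \<subseteq> level (l k i) \<times> level (l k i)"
    and small: "\<And>k. (\<Sum>i. ennreal (real (card (P k i)) / 4 ^ l k i)) \<le> ennreal (1 / 8 ^ Suc k)"
  shows "\<exists>S \<omega>. infinite S \<and> (\<forall>k i. \<forall>(\<sigma>, \<tau>)\<in>P k i.
    take k \<sigma> \<noteq> take k \<tau> \<longrightarrow> \<not> (\<sigma> \<in> coin_tree S \<omega> \<and> \<tau> \<in> coin_tree S \<omega>))"
proof -
  \<comment> \<open>The weights form a measure on the indices of the covering cylinders, and the splitting levels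
    are chosen sparse for that measure.\<close>
  define w where "w = (\<lambda>(k, i). 4 ^ k * ennreal (real (card (P k i)) / 4 ^ l k i))"
  define M where "M = density (count_space UNIV) w"
  have "emeasure M (space M) = (\<integral>\<^sup>+p. w p \<partial>count_space UNIV)"
    by (simp add: M_def emeasure_density)
  also have "\<dots> = (\<Sum>k. 4 ^ k * (\<Sum>i. ennreal (real (card (P k i)) / 4 ^ l k i)))"
    by (simp add: nn_integral_count_space_nat_pairs w_def)
  also have "\<dots> \<le> (\<Sum>k. ennreal (1 / 8 * (1 / 2) ^ k))"
  proof (rule suminf_le)
    fix k :: nat
    have "4 ^ k * (\<Sum>i. ennreal (real (card (P k i)) / 4 ^ l k i)) \<le> ennreal (4 ^ k) * ennreal (1 / 8 ^ Suc k)"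
      using small[of k] by (simp add: ennreal_power[symmetric] mult_left_mono del: power_Suc)
    also have "\<dots> = ennreal (4 ^ k * (1 / 8 ^ Suc k))" by (rule ennreal_mult[symmetric]) auto
    also have "4 ^ k * (1 / 8 ^ Suc k) = 1 / 8 * (1 / 2 :: real) ^ k"
    proof -
      have "(8::real) ^ k = 4 ^ k * 2 ^ k" by (simp flip: power_mult_distrib)
      then show ?thesis by (simp add: power_divide)
    qed
    finally show "4 ^ k * (\<Sum>i. ennreal (real (card (P k i)) / 4 ^ l k i)) \<le> ennreal (1 / 8 * (1 / 2) ^ k)" .
  qed auto
  also have "\<dots> = ennreal (1 / 4)"
    using sums_mult[OF geometric_sums[of "1/2::real"], of "1/8"]
    by (intro suminf_ennreal_eq) auto
  finally have total: "emeasure M (space M) \<le> ennreal (1 / 4)" .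
  have "finite_measure M"
    by (rule finite_measureI) (use total in \<open>auto simp: top_unique\<close>)
  then obtain S where S: "infinite S"
    "(\<integral>\<^sup>+p. 4 ^ card (S \<inter> {..<(\<lambda>(k, i). l k i) p}) \<partial>M) \<le> emeasure M (space M) + ennreal (1 / 4)"
    using sparse_set_weights[of M "\<lambda>(k, i). l k i" "1/4"] by (auto simp: M_def)
  define bad where "bad k i = {\<omega>. \<exists>(\<sigma>, \<tau>)\<in>P k i. take k \<sigma> \<noteq> take k \<tau> \<and>
      \<sigma> \<in> coin_tree S \<omega> \<and> \<tau> \<in> coin_tree S \<omega>}" for k i
  have bad_sets: "bad k i \<in> sets tree_coins" for k i
    unfolding bad_def by (rule bad_event_prob(1)[OF P])
  have "emeasure tree_coins (\<Union>k. \<Union>i. bad k i) \<le> (\<Sum>k. emeasure tree_coins (\<Union>i. bad k i))"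
    using bad_sets by (intro emeasure_subadditive_countably) auto
  also have "\<dots> \<le> (\<Sum>k. \<Sum>i. emeasure tree_coins (bad k i))"
    using bad_sets by (intro suminf_le emeasure_subadditive_countably) auto
  also have "\<dots> \<le> (\<Sum>k. \<Sum>i. w (k, i) * 4 ^ card (S \<inter> {..<l k i}))"
    unfolding bad_def w_def prod.case by (intro suminf_le bad_event_prob(2) P) auto
  also have "\<dots> = (\<integral>\<^sup>+p. 4 ^ card (S \<inter> {..<(\<lambda>(k, i). l k i) p}) \<partial>M)"
    by (simp add: M_def nn_integral_density nn_integral_count_space_nat_pairs)
  also have "\<dots> \<le> ennreal (1 / 4) + ennreal (1 / 4)"
    using S(2) total by (meson add_right_mono order_trans)
  also have "\<dots> = ennreal (1 / 2)" by (subst ennreal_plus[symmetric]) simp_all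
  also have "\<dots> < 1" using ennreal_less_iff[of "1/2" 1] by simp
  finally have "emeasure tree_coins (\<Union>k. \<Union>i. bad k i) < 1" .
  moreover have "emeasure tree_coins UNIV = 1"
    using prob_space.emeasure_space_1[of tree_coins]
    by (simp add: tree_coins_def prob_space_PiM measure_pmf.prob_space_axioms space_PiM)
  ultimately have "(\<Union>k. \<Union>i. bad k i) \<noteq> UNIV" by auto
  then obtain \<omega> where "\<And>k i. \<omega> \<notin> bad k i" by blast
  then show ?thesis using S(1) by (intro exI[of _ S] exI[of _ \<omega>]) (auto simp: bad_def)
qed

theorem theorem11:
  fixes F :: "((nat \<Rightarrow> bool) \<times> (nat \<Rightarrow> bool)) set"
  assumes "full_measure (coin_measure \<Otimes>\<^sub>M coin_measure) F"
  shows "\<exists>T. uniformly_perfect T \<and> body T \<times> body T \<subseteq> F \<union> {(x, x) |x. x \<in> UNIV}"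
proof -
  obtain N where N: "N \<in> null_sets (coin_measure \<Otimes>\<^sub>M coin_measure)" "- F \<subseteq> N"
    using assms by (auto simp: full_measure_def null_sets_completion_iff2 space_pair_measure Compl_eq_Diff_UNIV)
  \<comment> \<open>The \<open>k\<close>-th cover handles the pairs of branches that differ below level \<open>k\<close>. Its cylinders have
    depth at least \<open>k\<close>, so that the nodes witnessing membership in them already differ.\<close>
  define covers where "covers k l P \<longleftrightarrow> (\<forall>i::nat. k \<le> l i \<and> P i \<subseteq> level (l i) \<times> level (l i)) \<and>
      N \<subseteq> (\<Union>i. cylinder (l i) (P i)) \<and>
      (\<Sum>i. ennreal (real (card (P i)) / 4 ^ l i)) \<le> ennreal (1 / 8 ^ Suc k)" for k l P
  have "\<exists>l P. covers k l P" for k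
    unfolding covers_def by (intro null_set_cylinder_cover N) simp
  then obtain l P where "\<And>k. covers k (l k) (P k)" by metis
  then have lP: "\<And>k i::nat. k \<le> l k i" "\<And>k i. P k i \<subseteq> level (l k i) \<times> level (l k i)"
    "\<And>k. N \<subseteq> (\<Union>i. cylinder (l k i) (P k i))"
    "\<And>k. (\<Sum>i. ennreal (real (card (P k i)) / 4 ^ l k i)) \<le> ennreal (1 / 8 ^ Suc k)"
    unfolding covers_def by blast+
  obtain S \<omega> where S: "infinite S" and avoid: "\<And>k i \<sigma> \<tau>. (\<sigma>, \<tau>) \<in> P k i \<Longrightarrow> take k \<sigma> \<noteq> take k \<tau> \<Longrightarrow>
      \<not> (\<sigma> \<in> coin_tree S \<omega> \<and> \<tau> \<in> coin_tree S \<omega>)"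
    using coin_tree_avoiding_covers[of P l, OF lP(2,4)] by blast
  have "(x, y) \<in> F" if xy: "x \<in> body (coin_tree S \<omega>)" "y \<in> body (coin_tree S \<omega>)" "x \<noteq> y" for x y
  proof (rule ccontr)
    assume "(x, y) \<notin> F"
    then have "(x, y) \<in> N" using N by auto
    obtain n where n: "x n \<noteq> y n" using \<open>x \<noteq> y\<close> by auto
    define k where "k = Suc n"
    obtain i where i: "(restr x (l k i), restr y (l k i)) \<in> P k i"
      using lP(3)[of k] \<open>(x, y) \<in> N\<close> by (auto simp: cylinder_def)
    have "restr x k \<noteq> restr y k" using n by (auto simp: restr_def k_def simp del: upt_Suc)
    then have "take k (restr x (l k i)) \<noteq> take k (restr y (l k i))"
      by (simp add: take_restr lP(1))
    then show False using avoid[OF i] xy by (auto simp: body_def)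
  qed
  then show ?thesis
    using uniformly_perfect_coin_tree[OF S] by (intro exI[of _ "coin_tree S \<omega>"]) auto
qed

end
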